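(* Let $\mathcal D\subseteq[0,1]^7$ be the set of admissible parameters $(a,b,c,d,e,f,g)$ of the two-pentagon configuration (defined in the context), let $W$ be the union of the interiors of the two white pentagons and let $B$ be the non-attacked region of $W$ in the unit square. Then the maximum of $\min(\mathrm{Area}(W),\mathrm{Area}(B))$ over $\mathcal D$ equals $\frac{7}{48}$, and it is attained by Jubin's construction, i.e. when the white queens are located inside the pentagons $$[[0,0],[\tfrac14,\tfrac14],[\tfrac14,\tfrac12],[\tfrac16,\tfrac12],[0,\tfrac13]]\quad\text{and}\quad [[\tfrac12,0],[\tfrac34,0],[\tfrac34,\tfrac14],[\tfrac23,\tfrac13],[\tfrac12,\tfrac16]],$$ and the black queens reside inside the pentagons $$[[\tfrac12,1],[\tfrac14,1],[\tfrac14,\tfrac34],[\tfrac13,\tfrac23],[\tfrac12,\tfrac56]]\quad\text{and}\quad [[1,1],[\tfrac34,\tfrac34],[\tfrac34,\tfrac12],[\tfrac56,\tfrac12],[1,\tfrac23]].$$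
   Context: The chess board is normalized to the unit square $U=[0,1]^2$. A list $[[x_1,y_1],\dots,[x_n,y_n]]$ denotes the polygon with these vertices in this cyclic order (some sides may have length zero). For a region $W\subseteq U$ (white queens), its non-attacked region (where black queens may be placed) is $$B=\{(x,y)\in U:\ \forall (u,v)\in W,\ x\ne u,\ y\ne v,\ x+y\neq u+v,\ y-x\neq v-u\}.$$ Two-pentagon configuration with parameters $a,b,c,d,e,f,g\in[0,1]$: the white queens occupy the union $W$ of the interiors of the white pentagons $$[[0,0],[a,a],[a,a+b-e],[a-e,a+b-e],[0,b]],\qquad [[g,0],[g+c,0],[g+c,c-2f+d],[g+c-f,c-f+d],[g,d]].$$ The associated black pentagons are $$[[g,1],[a,1],[a,g+2c-2f+d-a],[\tfrac12 g+\tfrac12 d-\tfrac12 b+c-f,\ \tfrac12 g+\tfrac12 d+\tfrac12 b+c-f],[g,g+b]],$$ $$[[1,1],[g+c,g+c],[g+c,a+b-e],[a+b-e+g-d,a+b-e],[1,1+d-g]].$$ The parameters are admissible (belong to $\mathcal D$) if all vertices of these four pentagons lie in $U$, all side lengths are non-negative, i.e. $$a-e\ge0,\quad b-e\ge0,\quad c-f\ge 0,\quad c-2f+d\ge0,$$ $$g-a\ge0,\quad 1-(g+2c-2f+d-a)\ge0,\quad \tfrac12(g+d-b)+c-f-a\ge0,\quad \tfrac12(g-d+b)-c+f\ge0,\quad 1-g-b\ge0,$$ $$1-g-c\ge0,\quad g+c-(a+b-e)\ge0,\quad a+b-e-d-c\ge0,\quad 1-(a+b-e+g-d)\ge0,\quad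 g-d\ge0,$$ and the non-attacked region $B$ of $W$ coincides, up to a set of area zero, with the union of the two black pentagons. Jubin's construction is the case $a=\frac14,\ b=\frac13,\ c=\frac14,\ d=\frac16,\ e=\frac1{12},\ f=\frac1{12},\ g=\frac12$. *)

theory Defs
  imports "HOL-Analysis.Analysis"
begin

type_synonym point = "real \<times> real"

text \<open>Parameters \<open>(a, b, c, d, e, f, g)\<close>.\<close>
type_synonym params = "real \<times> real \<times> real \<times> real \<times> real \<times> real \<times> real"

definition board :: "point set" where
  "board = {0..1} \<times> {0..1}"

definition polygon_boundary :: "point list \<Rightarrow> point set" where
  "polygon_boundary vs =
     (\<Union>i<length vs. closed_segment (vs ! i) (vs ! (Suc i mod length vs)))"

text \<open>
  The closed planar region bounded by the closed polygonal line through the given vertices in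
  cyclic order. Repeated vertices (sides of length zero) are allowed.
\<close>
definition polygon :: "point list \<Rightarrow> point set" where
  "polygon vs = polygon_boundary vs \<union> inside (polygon_boundary vs)"

definition non_attacked :: "point set \<Rightarrow> point set" where
  "non_attacked W =
     {(x, y). (x, y) \<in> board \<and>
        (\<forall>(u, v) \<in> W. x \<noteq> u \<and> y \<noteq> v \<and> x + y \<noteq> u + v \<and> y - x \<noteq> v - u)}"

definition area :: "point set \<Rightarrow> real" where
  "area S = measure lebesgue S"

definition eq_up_to_null :: "point set \<Rightarrow> point set \<Rightarrow> bool" where
  "eq_up_to_null S T \<longleftrightarrow> sym_diff S T \<in> null_sets lebesgue"

fun white1 :: "params \<Rightarrow> point list" where
  "white1 (a, b, c, d, e, f, g) =
     [(0, 0), (a, a), (a, a + b - e), (a - e, a + b - e), (0, b)]"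

fun white2 :: "params \<Rightarrow> point list" where
  "white2 (a, b, c, d, e, f, g) =
     [(g, 0), (g + c, 0), (g + c, c - 2 * f + d), (g + c - f, c - f + d), (g, d)]"

fun black1 :: "params \<Rightarrow> point list" where
  "black1 (a, b, c, d, e, f, g) =
     [(g, 1), (a, 1), (a, g + 2 * c - 2 * f + d - a),
      (1/2 * g + 1/2 * d - 1/2 * b + c - f, 1/2 * g + 1/2 * d + 1/2 * b + c - f),
      (g, g + b)]"

fun black2 :: "params \<Rightarrow> point list" where
  "black2 (a, b, c, d, e, f, g) =
     [(1, 1), (g + c, g + c), (g + c, a + b - e), (a + b - e + g - d, a + b - e),
      (1, 1 + d - g)]"

definition white_region :: "params \<Rightarrow> point set" where
  "white_region p = interior (polygon (white1 p)) \<union> interior (polygon (white2 p))"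

definition black_region :: "params \<Rightarrow> point set" where
  "black_region p = non_attacked (white_region p)"

text \<open>
  Apart from a positive constant factor (1 or the square root of 2), the listed terms are the
  side lengths of the four pentagons that are not already one of the parameters.
\<close>
fun sides_nonneg :: "params \<Rightarrow> bool" where
  "sides_nonneg (a, b, c, d, e, f, g) \<longleftrightarrow>
     a - e \<ge> 0 \<and> b - e \<ge> 0 \<and> c - f \<ge> 0 \<and> c - 2 * f + d \<ge> 0 \<and>
     g - a \<ge> 0 \<and> 1 - (g + 2 * c - 2 * f + d - a) \<ge> 0 \<and>
     1/2 * (g + d - b) + c - f - a \<ge> 0 \<and> 1/2 * (g - d + b) - c + f \<ge> 0 \<and>
     1 - g - b \<ge> 0 \<and>
     1 - g - c \<ge> 0 \<and> g + c - (a + b - e) \<ge> 0 \<and> a + b - e - d - c \<ge> 0 \<and>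
     1 - (a + b - e + g - d) \<ge> 0 \<and> g - d \<ge> 0"

definition unit_cube7 :: "params set" where
  "unit_cube7 =
     {0..1} \<times> {0..1} \<times> {0..1} \<times> {0..1} \<times> {0..1} \<times> {0..1} \<times> {0..1}"

definition admissible :: "params set" where
  "admissible =
     {p \<in> unit_cube7.
        set (white1 p) \<union> set (white2 p) \<union> set (black1 p) \<union> set (black2 p) \<subseteq> board \<and>
        sides_nonneg p \<and>
        eq_up_to_null (black_region p) (polygon (black1 p) \<union> polygon (black2 p))}"

definition army_area :: "params \<Rightarrow> real" where
  "army_area p = min (area (white_region p)) (area (black_region p))"

definition jubin :: params where
  "jubin = (1/4, 1/3, 1/4, 1/6, 1/12, 1/12, 1/2)"

end

theory Submission
  imports Defs
begin

text \<open>
  The half turn about the centre of the board carries the two black pentagons to a pair of white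
  pentagons, with new parameters \<open>p'\<close> (\<open>dual p\<close>) that depend affinely on \<open>p\<close>. Hence a single
  quadratic form \<open>q\<close> (\<open>area_form\<close>) gives both areas: the white pentagons have area \<open>q p\<close>, the black
  ones \<open>q p'\<close>. Jubin's parameter vector \<open>J\<close> is a fixed point of the duality and \<open>q J = 7/48\<close>. The
  theorem therefore says that \<open>q p\<close> and \<open>q p'\<close> cannot both exceed \<open>q J\<close>.

  Let \<open>b\<close> be the symmetric bilinear form of \<open>q\<close>, and write \<open>p = s + t\<close>, \<open>p' = s - t\<close>, where \<open>s\<close> is the
  self-dual midpoint. The sum \<open>q p + q p'\<close> alone is not bounded by \<open>2 * q J\<close>: one army can
  grow at the expense of the other. This is compensated by the weights \<open>b J p'\<close> for the white excess
  and \<open>b J p\<close> for the black one. Both are non-negative and \<open>b J s = q J\<close>, so that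

    \<open>b J p' * (q p - q J) + b J p * (q p' - q J)
       = 2 * q J * (q s - q J) + 2 * (q J * q t - 2 * b J t * b s t)\<close>.

  The first summand is non-positive because on self-dual vectors \<open>q s - q J\<close> is minus a
  sum of two squares. The second one is affine in \<open>s\<close> for fixed \<open>t\<close>. The non-negativity of the sides
  \<open>d\<close>, \<open>e\<close>, \<open>f\<close> of both \<open>p\<close> and \<open>p'\<close> confines \<open>s\<close> to a triangle, and at each of its three vertices the
  second summand is a negative semidefinite quadratic form in \<open>t\<close>. So the left-hand side is
  non-positive, which is the lemma \<open>weighted_excess_nonpos\<close> with everything scaled to integers.

  The geometric part identifies the polygons, which are defined by means of the inside of a closed
  polygonal line, with convex regions cut out by five half-planes (\<open>bounds_halfplanes\<close>). Their areas
  follow by integration (\<open>area_cut_parallelogram\<close>, \<open>area_cut_trapezium\<close>). That Jubin's configuration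
  is admissible comes down to the columns, rows and diagonals that meet its white pentagons
  (\<open>jubin_attacks\<close>).
\<close>

section \<open>Polygons that bound a convex region\<close>

text \<open>
  Only the inclusion of the frontier in the closed polygonal line is demanded, not equality.
  This also covers degenerate pentagons, whose region has empty interior.
\<close>
definition bounds :: "point list \<Rightarrow> point set \<Rightarrow> bool" where
  "bounds vs C \<longleftrightarrow> compact C \<and> convex C \<and> set vs \<subseteq> C \<and> frontier C \<subseteq> polygon_boundary vs"

lemma polygon_boundary_subset:
  assumes "convex C" "set vs \<subseteq> C"
  shows "polygon_boundary vs \<subseteq> C"
proof -
  have "closed_segment (vs ! i) (vs ! (Suc i mod length vs)) \<subseteq> C" if "i < length vs" for i
  proof (rule closed_segment_subset[OF _ _ assms(1)])
    have "Suc i mod length vs < length vs"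
      using that by (intro mod_less_divisor) linarith
    then show "vs ! i \<in> C" "vs ! (Suc i mod length vs) \<in> C"
      using that assms(2) nth_mem by blast+
  qed
  then show ?thesis
    unfolding polygon_boundary_def by blast
qed

text \<open>
  Outside a convex set that contains the vertices one can escape to infinity without meeting the
  polygonal line.
\<close>
lemma bounds_polygon_subset:
  assumes "bounds vs C" shows "polygon vs \<subseteq> C"
proof -
  have "- C \<subseteq> outside (polygon_boundary vs)"
    using assms polygon_boundary_subset unfolding bounds_def by (intro outside_subset_convex) auto
  then show ?thesis
    using assms polygon_boundary_subset inside_Int_outside
    unfolding bounds_def polygon_def by blast
qed

text \<open>
  The inside of the frontier of a bounded convex set is its interior, and enlarging the frontier to
  the whole polygonal line can only move points from the inside onto the line.
\<close>
lemma bounds_interior_subset: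
  assumes "bounds vs C" shows "interior C \<subseteq> polygon vs"
proof -
  have "interior C = inside (frontier C)"
    using assms inside_frontier_eq_interior compact_imp_bounded unfolding bounds_def by blast
  also have "\<dots> \<subseteq> polygon_boundary vs \<union> inside (polygon_boundary vs)"
    using assms inside_mono[of "frontier C" "polygon_boundary vs"] unfolding bounds_def by blast
  finally show ?thesis
    unfolding polygon_def .
qed

lemma bounds_interior_polygon:
  assumes "bounds vs C" shows "interior (polygon vs) = interior C"
proof
  show "interior (polygon vs) \<subseteq> interior C"
    using bounds_polygon_subset[OF assms] by (rule interior_mono)
  show "interior C \<subseteq> interior (polygon vs)"
    using bounds_interior_subset[OF assms] by (simp add: interior_maximal)
qed

lemma bounds_frontier_negligible:
  assumes "bounds vs C" shows "negligible (C - interior C)"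
proof -
  have "C - interior C = frontier C"
    using assms compact_imp_closed unfolding bounds_def frontier_def by (metis closure_closed)
  then show ?thesis
    using assms negligible_convex_frontier unfolding bounds_def by metis
qed

text \<open>
  A point of \<open>C\<close> off the polygonal line satisfies every defining inequality strictly and
  is therefore interior. So it suffices to locate the points at which some inequality is tight.
\<close>
lemma bounds_halfplanes:
  fixes H :: "(point \<times> real) list"
  assumes C: "C = {z. \<forall>(n, k) \<in> set H. n \<bullet> z \<le> k}"
    and bdd: "bounded C"
    and vs: "set vs \<subseteq> C"
    and edge: "\<And>n k z. (n, k) \<in> set H \<Longrightarrow> z \<in> C \<Longrightarrow> n \<bullet> z = k \<Longrightarrow> z \<in> polygon_boundary vs"
  shows "bounds vs C"
proof -
  have C': "C = (\<Inter>(n, k) \<in> set H. {z. n \<bullet> z \<le> k})"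
    unfolding C by auto
  have clo: "closed C"
    unfolding C' by (intro closed_INT) (auto simp: closed_halfspace_le)
  have con: "convex C"
    unfolding C' by (intro convex_INT) (auto simp: convex_halfspace_le)
  let ?S = "\<Inter>(n, k) \<in> set H. {z. n \<bullet> z < k}"
  have "open ?S"
    by (intro open_INT) (auto simp: open_halfspace_lt)
  moreover have "?S \<subseteq> C"
    unfolding C' by fastforce
  ultimately have "?S \<subseteq> interior C"
    by (simp add: interior_maximal)
  moreover have "C - polygon_boundary vs \<subseteq> ?S"
    using edge unfolding C by (force simp: order.strict_iff_order)
  ultimately have "C - interior C \<subseteq> polygon_boundary vs"
    by blast
  then have "frontier C \<subseteq> polygon_boundary vs"
    using clo unfolding frontier_def by simp
  then show ?thesis
    using clo con bdd vs unfolding bounds_def by (simp add: compact_eq_bounded_closed)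
qed

text \<open>
  The sides of the pentagons are given by a start, a direction and a length, which may be zero.
\<close>
lemma closed_segment_ray:
  fixes P v :: point
  assumes "0 \<le> t" "t \<le> l"
  shows "P + t *\<^sub>R v \<in> closed_segment P (P + l *\<^sub>R v)"
proof (cases "l = 0")
  case False
  then have "P + t *\<^sub>R v = (1 - t / l) *\<^sub>R P + (t / l) *\<^sub>R (P + l *\<^sub>R v)"
    by (simp add: algebra_simps)
  then show ?thesis
    using assms False unfolding closed_segment_def by (auto intro!: exI[of _ "t / l"])
qed (use assms in auto)

lemma polygon_boundary_pentagon:
  "polygon_boundary [p0, p1, p2, p3, p4] =
     closed_segment p0 p1 \<union> closed_segment p1 p2 \<union> closed_segment p2 p3 \<union>
     closed_segment p3 p4 \<union> closed_segment p4 p0"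
proof -
  have "{..<length [p0, p1, p2, p3, p4]} = {0, 1, 2, 3, 4}"
    by auto
  then show ?thesis
    unfolding polygon_boundary_def by (simp add: Un_assoc)
qed

section \<open>The half turn of the board\<close>

lemma polygon_boundary_map:
  assumes "\<And>x y. h ` closed_segment x y = closed_segment (h x) (h y)"
  shows "polygon_boundary (map h vs) = h ` polygon_boundary vs"
proof -
  have "closed_segment (map h vs ! i) (map h vs ! (Suc i mod length vs))
      = h ` closed_segment (vs ! i) (vs ! (Suc i mod length vs))" if "i < length vs" for i
  proof -
    have "Suc i mod length vs < length vs"
      using that by (intro mod_less_divisor) linarith
    then show ?thesis
      using that assms by simp
  qed
  then show ?thesis
    unfolding polygon_boundary_def by (simp add: image_UN)
qed

definition half_turn :: "point \<Rightarrow> point" where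
  "half_turn z = (1, 1) - z"

lemma half_turn_eq: "half_turn = (+) (1, 1) \<circ> uminus"
  by (auto simp: half_turn_def)

lemma half_turn_Pair [simp]: "half_turn (x, y) = (1 - x, 1 - y)"
  by (simp add: half_turn_def)

lemma half_turn_half_turn [simp]: "half_turn (half_turn z) = z"
  by (simp add: half_turn_def)

lemma linear_uminus: "linear (uminus :: 'a::real_vector \<Rightarrow> 'a)"
  by (auto intro: linearI)

lemma compact_half_turn:
  assumes "compact C" shows "compact (half_turn ` C)"
  unfolding half_turn_def using assms by (intro compact_continuous_image continuous_intros)

lemma bounds_half_turn:
  assumes "bounds vs C"
  shows "bounds (map half_turn vs) (half_turn ` C)"
proof -
  have seg: "half_turn ` closed_segment x y = closed_segment (half_turn x) (half_turn y)" for x y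
    unfolding half_turn_eq image_comp[symmetric] o_apply
      closed_segment_linear_image[OF linear_uminus, symmetric]
      closed_segment_translation ..
  have im: "half_turn ` C = (+) (1, 1) ` (uminus ` C)"
    unfolding half_turn_eq image_comp[symmetric] ..
  have "frontier (uminus ` C) = uminus ` frontier C"
    unfolding frontier_def image_set_diff[OF inj_uminus]
      closure_injective_linear_image[OF linear_uminus inj_uminus]
      interior_injective_linear_image[OF linear_uminus inj_uminus] ..
  then have "frontier (half_turn ` C) = half_turn ` frontier C"
    unfolding im frontier_translation by (simp add: half_turn_eq image_comp)
  moreover have "compact (half_turn ` C)"
    using assms compact_half_turn unfolding bounds_def by blast
  moreover have "convex (half_turn ` C)"
    unfolding im by (intro convex_translation convex_negations) (use assms bounds_def in blast)
  moreover have "half_turn ` frontier C \<subseteq> half_turn ` polygon_boundary vs"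
    using assms unfolding bounds_def by (intro image_mono) simp
  moreover have "set (map half_turn vs) \<subseteq> half_turn ` C"
    using assms unfolding bounds_def by auto
  ultimately show ?thesis
    unfolding bounds_def polygon_boundary_map[OF seg] by simp
qed

lemma area_half_turn: "area (half_turn ` S) = area S"
  unfolding area_def half_turn_eq image_comp[symmetric] measure_translation
  using measure_lebesgue_affine[of "-1" 0 S] by simp

section \<open>Areas of the white pentagons\<close>

text \<open>
  Cavalieri's principle: the vertical section at \<open>x\<close> is an interval of length \<open>u x - l x\<close>.
\<close>
lemma area_between_graphs:
  fixes l u :: "real \<Rightarrow> real"
  assumes cont: "continuous_on UNIV l" "continuous_on UNIV u"
    and le: "\<And>x. x \<in> {x0..x1} \<Longrightarrow> l x \<le> u x"
    and I: "((\<lambda>x. u x - l x) has_integral I) {x0..x1}"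
  shows "area {(x, y). x0 \<le> x \<and> x \<le> x1 \<and> l x \<le> y \<and> y \<le> u x} = I"
proof -
  let ?A = "{(x, y). x0 \<le> x \<and> x \<le> x1 \<and> l x \<le> y \<and> y \<le> u x}"
  let ?f = "\<lambda>x. if x \<in> {x0..x1} then u x - l x else 0"
  have [measurable]: "l \<in> borel_measurable borel" "u \<in> borel_measurable borel"
    using cont by (auto intro: borel_measurable_continuous_onI)
  have A: "?A \<in> sets borel"
  proof -
    have "?A = {z \<in> space (borel \<Otimes>\<^sub>M borel).
        x0 \<le> fst z \<and> fst z \<le> x1 \<and> l (fst z) \<le> snd z \<and> snd z \<le> u (fst z)}"
      by (auto simp: space_pair_measure)
    also have "\<dots> \<in> sets (borel \<Otimes>\<^sub>M borel)"
      by measurable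
    finally show ?thesis
      unfolding borel_prod .
  qed
  have I': "(?f has_integral I) UNIV"
    using I unfolding has_integral_restrict_UNIV .
  have "emeasure lborel ?A = (\<integral>\<^sup>+x. emeasure lborel (Pair x -` ?A) \<partial>lborel)"
    using lborel.emeasure_pair_measure_alt[of ?A "lborel :: real measure"] A
    unfolding lborel_prod sets_lborel by blast
  also have "\<dots> = (\<integral>\<^sup>+x. ennreal (?f x) \<partial>lborel)"
  proof (rule nn_integral_cong)
    fix x
    have "Pair x -` ?A = (if x \<in> {x0..x1} then {l x..u x} else {})"
      by auto
    then show "emeasure lborel (Pair x -` ?A) = ennreal (?f x)"
      using le[of x] by simp
  qed
  also have "\<dots> = ennreal I"
  proof (rule nn_integral_has_integral_lborel[OF _ _ I'])
    show "?f \<in> borel_measurable borel" by measurable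
  qed (use le in auto)
  finally have "measure lborel ?A = I"
    using has_integral_nonneg[OF I] le by (simp add: measure_def)
  then show ?thesis
    using A by (simp add: area_def)
qed

text \<open>
  The height of a white pentagon is an affine function of \<open>x\<close> up to the abscissa \<open>t\<close> at which
  the cut corner begins, and from there on its slope drops by \<open>r\<close>.
\<close>
lemma has_integral_cut_corner:
  fixes p q r :: real
  assumes "x0 \<le> t" "t \<le> x1"
  shows "((\<lambda>x. p + q * (x - x0) - r * max 0 (x - t)) has_integral
    p * (x1 - x0) + q * (x1 - x0)\<^sup>2 / 2 - r * (x1 - t)\<^sup>2 / 2) {x0..x1}"
proof -
  have linear: "((\<lambda>x. p + q * (x - x0)) has_integral
      (p * (x1 - x0) + q * (x1 - x0)\<^sup>2 / 2) - (p * (x0 - x0) + q * (x0 - x0)\<^sup>2 / 2)) {x0..x1}"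
    using assms
    by (intro fundamental_theorem_of_calculus)
       (auto intro!: derivative_eq_intros simp flip: has_real_derivative_iff_has_vector_derivative)
  have corner: "((\<lambda>x. max 0 (x - t)) has_integral (0 + (x1 - t)\<^sup>2 / 2)) {x0..x1}"
  proof (rule has_integral_combine[OF assms])
    show "((\<lambda>x. max 0 (x - t)) has_integral 0) {x0..t}"
      by (rule has_integral_eq[OF _ has_integral_0]) auto
    have "((\<lambda>x. x - t) has_integral ((x1 - t)\<^sup>2 / 2 - (t - t)\<^sup>2 / 2)) {t..x1}"
      using assms
      by (intro fundamental_theorem_of_calculus)
        (auto intro!: derivative_eq_intros simp flip: has_real_derivative_iff_has_vector_derivative)
    then show "((\<lambda>x. max 0 (x - t)) has_integral (x1 - t)\<^sup>2 / 2) {t..x1}"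
      by (auto elim: has_integral_eq[rotated])
  qed
  show ?thesis
    using has_integral_diff[OF linear has_integral_mult_right[OF corner, of r]] by simp
qed

text \<open>
  The first white pentagon is the parallelogram \<open>0 \<le> x \<le> a\<close>, \<open>x \<le> y \<le> x + b\<close> without the
  triangle above the horizontal side of length \<open>e\<close>.
\<close>
definition cut_parallelogram :: "real \<Rightarrow> real \<Rightarrow> real \<Rightarrow> point set" where
  "cut_parallelogram a b e = {(x, y). 0 \<le> x \<and> x \<le> a \<and> x \<le> y \<and> y \<le> min (x + b) (a + b - e)}"

text \<open>
  The second white pentagon is the trapezium \<open>g \<le> x \<le> g + c\<close>, \<open>0 \<le> y \<le> x - g + d\<close> without the
  triangle above its antidiagonal side.
\<close>
definition cut_trapezium :: "real \<Rightarrow> real \<Rightarrow> real \<Rightarrow> real \<Rightarrow> point set" where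
  "cut_trapezium c d f g =
     {(x, y). g \<le> x \<and> x \<le> g + c \<and> 0 \<le> y \<and> y \<le> min (x - g + d) (g + d + 2 * c - 2 * f - x)}"

lemma bounds_cut_parallelogram:
  assumes "0 \<le> e" "e \<le> a" "e \<le> b"
  shows "bounds [(0, 0), (a, a), (a, a + b - e), (a - e, a + b - e), (0, b)]
    (cut_parallelogram a b e)" (is "bounds ?vs ?C")
proof -
  let ?H = "[((-1, 0), 0), ((1, 0), a), ((1, -1), 0), ((-1, 1), b), ((0, 1), a + b - e)]"
  show ?thesis
  proof (rule bounds_halfplanes[where H = ?H])
    show "bounded ?C"
      by (rule bounded_subset[OF bounded_cbox[of "(0, 0)" "(a, a + b - e)"]])
        (auto simp: cut_parallelogram_def cbox_Pair_eq)
    fix n k z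
    assume nk: "(n, k) \<in> set ?H" and z: "z \<in> ?C" "n \<bullet> z = k"
    obtain x y where xy: "z = (x, y)"
      by (cases z)
    have C: "0 \<le> x" "x \<le> a" "x \<le> y" "y \<le> x + b" "y \<le> a + b - e"
      using z(1) unfolding xy cut_parallelogram_def by auto
    from nk z(2) consider "x = 0" | "x = a" | "y = x" | "y = x + b" | "y = a + b - e"
      unfolding xy by fastforce
    then show "z \<in> polygon_boundary ?vs"
    proof cases
      case 1
      then have "z \<in> closed_segment (0, b) (0, 0)"
        using closed_segment_ray[of "b - y" b "(0, b)" "(0, -1)"] C xy by simp
      then show ?thesis unfolding polygon_boundary_pentagon by simp
    next
      case 2
      then have "z \<in> closed_segment (a, a) (a, a + b - e)"
        using closed_segment_ray[of "y - a" "b - e" "(a, a)" "(0, 1)"] C xy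
        by (simp add: algebra_simps)
      then show ?thesis unfolding polygon_boundary_pentagon by simp
    next
      case 3
      then have "z \<in> closed_segment (0, 0) (a, a)"
        using closed_segment_ray[of x a "(0, 0)" "(1, 1)"] C xy by simp
      then show ?thesis unfolding polygon_boundary_pentagon by simp
    next
      case 4
      then have "z \<in> closed_segment (a - e, a + b - e) (0, b)"
        using closed_segment_ray[of "a - e - x" "a - e" "(a - e, a + b - e)" "(-1, -1)"] C xy
        by (simp add: algebra_simps)
      then show ?thesis unfolding polygon_boundary_pentagon by simp
    next
      case 5
      then have "z \<in> closed_segment (a, a + b - e) (a - e, a + b - e)"
        using closed_segment_ray[of "a - x" e "(a, a + b - e)" "(-1, 0)"] C xy by simp
      then show ?thesis unfolding polygon_boundary_pentagon by simp
    qed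
  qed (use assms in \<open>auto simp: cut_parallelogram_def\<close>)
qed

lemma bounds_cut_trapezium:
  assumes "0 \<le> d" "0 \<le> f" "f \<le> c" "2 * f \<le> c + d"
  shows "bounds [(g, 0), (g + c, 0), (g + c, c - 2 * f + d), (g + c - f, c - f + d), (g, d)]
    (cut_trapezium c d f g)" (is "bounds ?vs ?C")
proof -
  let ?H = "[((-1, 0), -g), ((1, 0), g + c), ((0, -1), 0), ((-1, 1), d - g),
    ((1, 1), g + d + 2 * c - 2 * f)]"
  show ?thesis
  proof (rule bounds_halfplanes[where H = ?H])
    show "bounded ?C"
      by (rule bounded_subset[OF bounded_cbox[of "(g, 0)" "(g + c, c + d)"]])
        (auto simp: cut_trapezium_def cbox_Pair_eq)
    fix n k z
    assume nk: "(n, k) \<in> set ?H" and z: "z \<in> ?C" "n \<bullet> z = k"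
    obtain x y where xy: "z = (x, y)"
      by (cases z)
    have C: "g \<le> x" "x \<le> g + c" "0 \<le> y" "y \<le> x - g + d" "y \<le> g + d + 2 * c - 2 * f - x"
      using z(1) unfolding xy cut_trapezium_def by auto
    from nk z(2) consider "x = g" | "x = g + c" | "y = 0" | "y = x - g + d"
      | "y = g + d + 2 * c - 2 * f - x"
      unfolding xy by fastforce
    then show "z \<in> polygon_boundary ?vs"
    proof cases
      case 1
      then have "z \<in> closed_segment (g, d) (g, 0)"
        using closed_segment_ray[of "d - y" d "(g, d)" "(0, -1)"] C xy by simp
      then show ?thesis unfolding polygon_boundary_pentagon by simp
    next
      case 2
      then have "z \<in> closed_segment (g + c, 0) (g + c, c - 2 * f + d)"
        using closed_segment_ray[of y "c - 2 * f + d" "(g + c, 0)" "(0, 1)"] C xy by simp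
      then show ?thesis unfolding polygon_boundary_pentagon by simp
    next
      case 3
      then have "z \<in> closed_segment (g, 0) (g + c, 0)"
        using closed_segment_ray[of "x - g" c "(g, 0)" "(1, 0)"] C xy by simp
      then show ?thesis unfolding polygon_boundary_pentagon by simp
    next
      case 4
      then have "z = (x, d + x - g)"
        unfolding xy by simp
      then have "z \<in> closed_segment (g + c - f, c - f + d) (g, d)"
        using closed_segment_ray[of "g + c - f - x" "c - f" "(g + c - f, c - f + d)" "(-1, -1)"]
          C 4 by (simp add: algebra_simps)
      then show ?thesis unfolding polygon_boundary_pentagon by simp
    next
      case 5
      then have "z = (x, g + d + 2 * c - 2 * f - x)"
        unfolding xy by simp
      then have "z \<in> closed_segment (g + c, c - 2 * f + d) (g + c - f, c - f + d)"
        using closed_segment_ray[of "g + c - x" f "(g + c, c - 2 * f + d)" "(-1, 1)"] C 5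
        by (simp add: algebra_simps)
      then show ?thesis unfolding polygon_boundary_pentagon by simp
    qed
  qed (use assms in \<open>auto simp: cut_trapezium_def\<close>)
qed

lemma area_cut_parallelogram:
  assumes "0 \<le> e" "e \<le> a" "e \<le> b"
  shows "area (cut_parallelogram a b e) = a * b - e\<^sup>2 / 2"
  unfolding cut_parallelogram_def
proof (rule area_between_graphs)
  have "((\<lambda>x. b + 0 * (x - 0) - 1 * max 0 (x - (a - e))) has_integral
      b * (a - 0) + 0 * (a - 0)\<^sup>2 / 2 - 1 * (a - (a - e))\<^sup>2 / 2) {0..a}"
    by (rule has_integral_cut_corner) (use assms in auto)
  moreover have "b + 0 * (x - 0) - 1 * max 0 (x - (a - e)) = min (x + b) (a + b - e) - x" for x
    by (simp add: min_def max_def)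
  ultimately show "((\<lambda>x. min (x + b) (a + b - e) - x) has_integral a * b - e\<^sup>2 / 2) {0..a}"
    by (simp add: mult.commute)
qed (use assms in \<open>auto intro!: continuous_intros\<close>)

lemma area_cut_trapezium:
  assumes "0 \<le> d" "0 \<le> f" "f \<le> c" "2 * f \<le> c + d"
  shows "area (cut_trapezium c d f g) = c * d + c\<^sup>2 / 2 - f\<^sup>2"
  unfolding cut_trapezium_def
proof (rule area_between_graphs)
  have "((\<lambda>x. d + 1 * (x - g) - 2 * max 0 (x - (g + c - f))) has_integral
      d * (g + c - g) + 1 * (g + c - g)\<^sup>2 / 2 - 2 * (g + c - (g + c - f))\<^sup>2 / 2) {g..g + c}"
    by (rule has_integral_cut_corner) (use assms in auto)
  moreover have "d + 1 * (x - g) - 2 * max 0 (x - (g + c - f))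
      = min (x - g + d) (g + d + 2 * c - 2 * f - x) - 0" for x
    by (simp add: min_def max_def)
  ultimately show "((\<lambda>x. min (x - g + d) (g + d + 2 * c - 2 * f - x) - 0) has_integral
      c * d + c\<^sup>2 / 2 - f\<^sup>2) {g..g + c}"
    by (simp add: mult.commute)
qed (use assms in \<open>auto intro!: continuous_intros\<close>)

section \<open>Equality up to null sets\<close>

lemma eq_up_to_null_iff: "eq_up_to_null S T \<longleftrightarrow> negligible (sym_diff S T)"
  by (simp add: eq_up_to_null_def negligible_iff_null_sets)

lemma eq_up_to_null_sym: "eq_up_to_null S T \<Longrightarrow> eq_up_to_null T S"
  by (simp add: eq_up_to_null_def Un_commute)

lemma eq_up_to_null_trans:
  assumes "eq_up_to_null S T" "eq_up_to_null T U" shows "eq_up_to_null S U"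
proof -
  have "negligible (sym_diff S T \<union> sym_diff T U)"
    using assms unfolding eq_up_to_null_iff by (rule negligible_Un)
  then show ?thesis
    unfolding eq_up_to_null_iff by (rule negligible_subset) blast
qed

lemma eq_up_to_null_Un:
  assumes "eq_up_to_null S T" "eq_up_to_null S' T'" shows "eq_up_to_null (S \<union> S') (T \<union> T')"
proof -
  have "negligible (sym_diff S T \<union> sym_diff S' T')"
    using assms unfolding eq_up_to_null_iff by (rule negligible_Un)
  then show ?thesis
    unfolding eq_up_to_null_iff by (rule negligible_subset) blast
qed

lemma area_cong_null:
  assumes "S \<in> lmeasurable" "eq_up_to_null S T" shows "area T = area S"
  unfolding area_def using assms by (intro measure_negligible_symdiff) (auto simp: eq_up_to_null_iff)

lemma bounds_compact: "bounds vs C \<Longrightarrow> compact C"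
  by (simp add: bounds_def)

lemma bounds_eq_polygon:
  assumes "bounds vs C" shows "eq_up_to_null C (polygon vs)"
proof -
  have "sym_diff C (polygon vs) \<subseteq> C - interior C"
    using bounds_polygon_subset[OF assms] bounds_interior_subset[OF assms] by blast
  then show ?thesis
    unfolding eq_up_to_null_iff by (rule negligible_subset[OF bounds_frontier_negligible[OF assms]])
qed

lemma bounds_eq_interior_polygon:
  assumes "bounds vs C" shows "eq_up_to_null C (interior (polygon vs))"
proof -
  have "sym_diff C (interior (polygon vs)) \<subseteq> C - interior C"
    unfolding bounds_interior_polygon[OF assms] using interior_subset by blast
  then show ?thesis
    unfolding eq_up_to_null_iff by (rule negligible_subset[OF bounds_frontier_negligible[OF assms]])
qed

section \<open>Duality of white and black parameters\<close>

text \<open>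
  The map is an affine involution. The parameters that are read off the black pentagons after
  turning the board upside down are the dual ones.
\<close>
fun dual :: "params \<Rightarrow> params" where
  "dual (a, b, c, d, e, f, g) =
     (1 - g - c, g - d, g - a, 1 - g - b, a + b - e - d - c,
      1/2 * (g + d - b) + c - f - a, 1 - g)"

fun area_form :: "params \<Rightarrow> real" where
  "area_form (a, b, c, d, e, f, g) = a * b - e\<^sup>2 / 2 + c * d + c\<^sup>2 / 2 - f\<^sup>2"

text \<open>
  The inequalities on the white side only; \<open>a \<le> g\<close> keeps the two pentagons from overlapping. The
  inequalities on the black side yield the same ones for the dual parameters.
\<close>
fun white_sides_nonneg :: "params \<Rightarrow> bool" where
  "white_sides_nonneg (a, b, c, d, e, f, g) \<longleftrightarrow>
     0 \<le> e \<and> e \<le> a \<and> e \<le> b \<and> 0 \<le> d \<and> 0 \<le> f \<and> f \<le> c \<and> 2 * f \<le> c + d \<and> a \<le> g"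

fun white_pentagons :: "params \<Rightarrow> point set" where
  "white_pentagons (a, b, c, d, e, f, g) = cut_parallelogram a b e \<union> cut_trapezium c d f g"

lemma bounds_white:
  assumes "white_sides_nonneg (a, b, c, d, e, f, g)"
  shows "bounds (white1 (a, b, c, d, e, f, g)) (cut_parallelogram a b e)"
    "bounds (white2 (a, b, c, d, e, f, g)) (cut_trapezium c d f g)"
  using assms bounds_cut_parallelogram[of e a b] bounds_cut_trapezium[of d f c g] by auto

lemma compact_white_pentagons:
  assumes "white_sides_nonneg p" shows "compact (white_pentagons p)"
proof (cases p)
  case (fields a b c d e f g)
  show ?thesis
    unfolding fields white_pentagons.simps
    using bounds_white assms[unfolded fields] by (intro compact_Un) (blast intro: bounds_compact)+
qed

text \<open>
  The parallelogram has area \<open>a * b\<close> and loses a right isosceles triangle with legs \<open>e\<close>; the trapezium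
  has area \<open>c * d + c\<^sup>2 / 2\<close> and loses a triangle with vertical side \<open>2 * f\<close> and height \<open>f\<close>.
\<close>
lemma area_white_pentagons:
  assumes "white_sides_nonneg p" shows "area (white_pentagons p) = area_form p"
proof (cases p)
  case (fields a b c d e f g)
  let ?P = "cut_parallelogram a b e" and ?T = "cut_trapezium c d f g"
  have m: "?P \<in> lmeasurable" "?T \<in> lmeasurable"
    using bounds_white assms[unfolded fields] lmeasurable_compact bounds_compact by blast+
  have "?P \<inter> ?T \<subseteq> {z. (1, 0) \<bullet> z = g}"
    using assms by (auto simp: fields cut_parallelogram_def cut_trapezium_def)
  then have "negligible (?P \<inter> ?T)"
    by (rule negligible_subset[OF negligible_hyperplane, rotated]) (simp add: zero_prod_def)
  then have "area (?P \<union> ?T) = area ?P + area ?T"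
    unfolding area_def using m by (simp add: measure_Un3 negligible_imp_measure0)
  then show ?thesis
    using assms by (simp add: fields area_cut_parallelogram area_cut_trapezium)
qed

lemma white_pentagons_eq_white_region:
  assumes "white_sides_nonneg p" shows "eq_up_to_null (white_pentagons p) (white_region p)"
proof (cases p)
  case (fields a b c d e f g)
  show ?thesis
    using bounds_white assms unfolding fields white_region_def white_pentagons.simps
    by (intro eq_up_to_null_Un bounds_eq_interior_polygon)
qed

text \<open>
  This is where the dual parameters come from: the half turn about the centre of the board maps the
  black pentagons to white ones.
\<close>
lemma black_eq_half_turn_white:
  "black1 p = map half_turn (white2 (dual p))" "black2 p = map half_turn (white1 (dual p))"
  by (cases p; simp add: field_simps)+

lemma half_turn_white_pentagons_eq_black:
  assumes "white_sides_nonneg (dual p)"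
  shows "eq_up_to_null (half_turn ` white_pentagons (dual p)) (polygon (black1 p) \<union> polygon (black2 p))"
proof (cases "dual p")
  case (fields a b c d e f g)
  have "eq_up_to_null (half_turn ` cut_trapezium c d f g) (polygon (black1 p))"
    "eq_up_to_null (half_turn ` cut_parallelogram a b e) (polygon (black2 p))"
    unfolding black_eq_half_turn_white fields
    using bounds_white assms unfolding fields by (intro bounds_eq_polygon bounds_half_turn; blast)+
  then have "eq_up_to_null (half_turn ` cut_trapezium c d f g \<union> half_turn ` cut_parallelogram a b e)
      (polygon (black1 p) \<union> polygon (black2 p))"
    by (rule eq_up_to_null_Un)
  then show ?thesis
    unfolding fields by (simp add: image_Un Un_commute)
qed

lemma admissible_sides:
  assumes "p \<in> admissible"
  shows "white_sides_nonneg p" "white_sides_nonneg (dual p)"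
proof -
  obtain a b c d e f g where p: "p = (a, b, c, d, e, f, g)"
    by (cases p)
  have "0 \<le> d" "0 \<le> e" "0 \<le> f" "sides_nonneg p"
    using assms by (simp_all add: admissible_def unit_cube7_def p)
  note sides = this(4)[unfolded p sides_nonneg.simps]
  have "e \<le> a" "e \<le> b" "f \<le> c" "2 * f \<le> c + d" "a \<le> g"
    using sides by simp_all
  then show "white_sides_nonneg p"
    using \<open>0 \<le> d\<close> \<open>0 \<le> e\<close> \<open>0 \<le> f\<close> by (simp add: p)
  have "a + b - e - d - c \<ge> 0" "1 - (a + b - e + g - d) \<ge> 0" "g + c - (a + b - e) \<ge> 0"
    "1 - g - b \<ge> 0" "1/2 * (g + d - b) + c - f - a \<ge> 0" "1/2 * (g - d + b) - c + f \<ge> 0"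
    "1 - (g + 2 * c - 2 * f + d - a) \<ge> 0"
    using sides by blast+
  moreover have "0 \<le> c"
    using \<open>0 \<le> f\<close> \<open>f \<le> c\<close> by simp
  moreover have "1/2 * (g + d - b) + c - f - a \<le> g - a \<longleftrightarrow> 1/2 * (g - d + b) - c + f \<ge> 0"
    "2 * (1/2 * (g + d - b) + c - f - a) \<le> (g - a) + (1 - g - b) \<longleftrightarrow>
      1 - (g + 2 * c - 2 * f + d - a) \<ge> 0"
    by argo+
  ultimately show "white_sides_nonneg (dual p)"
    unfolding p dual.simps white_sides_nonneg.simps by simp
qed

lemma admissible_areas:
  assumes "p \<in> admissible"
  shows "area (white_region p) = area_form p" "area (black_region p) = area_form (dual p)"
proof -
  note sides = admissible_sides[OF assms]
  show "area (white_region p) = area_form p"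
    using area_cong_null[OF lmeasurable_compact white_pentagons_eq_white_region]
      compact_white_pentagons area_white_pentagons sides
    by simp
  let ?S = "half_turn ` white_pentagons (dual p)"
  have "eq_up_to_null (black_region p) (polygon (black1 p) \<union> polygon (black2 p))"
    using assms unfolding admissible_def by blast
  then have "eq_up_to_null ?S (black_region p)"
    using half_turn_white_pentagons_eq_black[OF sides(2)] eq_up_to_null_sym eq_up_to_null_trans by blast
  moreover have "?S \<in> lmeasurable"
    using compact_white_pentagons[OF sides(2)] by (intro lmeasurable_compact compact_half_turn)
  ultimately have "area (black_region p) = area ?S"
    using area_cong_null by blast
  then show "area (black_region p) = area_form (dual p)"
    using area_white_pentagons[OF sides(2)] area_half_turn by simp
qed

section \<open>The weighted inequality between the two areas\<close>

text \<open>
  With \<open>b\<close> the symmetric bilinear form of \<open>area_form\<close>, this is \<open>24 * b jubin p\<close>. It is a multiple of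
  the derivative of \<open>area_form\<close> at Jubin's configuration.
\<close>
fun jubin_form :: "params \<Rightarrow> real" where
  "jubin_form (a, b, c, d, e, f, g) = 4 * a + 3 * b + 5 * c + 3 * d - e - 2 * f"

text \<open>
  A difference \<open>t\<close> of dual parameter vectors satisfies \<open>t\<^sub>d = t\<^sub>a + t\<^sub>b - t\<^sub>c\<close>, so that
  \<open>area_form t\<close> is \<open>a * b + b * c + a * c - c\<^sup>2 / 2 - e\<^sup>2 / 2 - f\<^sup>2\<close> and \<open>jubin_form t\<close> is
  \<open>7 * a + 6 * b + 2 * c - e - 2 * f\<close> in the remaining coordinates of \<open>t\<close>. The next three lemmas state
  \<open>7 * area_form t \<le> jubin_form t * (4 * b v t)\<close>, where \<open>b\<close> is the symmetric bilinear form of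
  \<open>area_form\<close> and \<open>v\<close> is one of the extreme self-dual configurations
  \<open>(0, 1/2, 1/2, 0, 0, 1/4, 1/2)\<close>, \<open>(1/4, 1/2, 1/4, 0, 1/4, 0, 1/2)\<close> and
  \<open>(1/2, 0, 0, 1/2, 0, 0, 1/2)\<close>. In each case the difference of the two sides is positive
  semidefinite, and completing squares one coordinate at a time diagonalizes it.
\<close>
lemma antisymmetric_form_le_vertex1:
  fixes a b c e f :: real
  shows "7 * (a * b + b * c + a * c - c\<^sup>2 / 2 - e\<^sup>2 / 2 - f\<^sup>2)
    \<le> (7 * a + 6 * b + 2 * c - e - 2 * f) * (2 * a + b - f)"
proof -
  have "(7 * a + 6 * b + 2 * c - e - 2 * f) * (2 * a + b - f)
      - 7 * (a * b + b * c + a * c - c\<^sup>2 / 2 - e\<^sup>2 / 2 - f\<^sup>2)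
    = 7/2 * (c - 3/7 * a - 5/7 * b - 2/7 * f)\<^sup>2 + 7/2 * (e - 2/7 * a - 1/7 * b + 1/7 * f)\<^sup>2
      + 29/7 * (b + 67/58 * a - 65/58 * f)\<^sup>2 + 399/116 * (f - 7/57 * a)\<^sup>2 + 427/57 * a\<^sup>2"
    by (simp add: field_simps power2_eq_square)
  also have "\<dots> \<ge> 0"
    by (intro add_nonneg_nonneg mult_nonneg_nonneg) simp_all
  finally show ?thesis
    by simp
qed

lemma antisymmetric_form_le_vertex2:
  fixes a b c e f :: real
  shows "7 * (a * b + b * c + a * c - c\<^sup>2 / 2 - e\<^sup>2 / 2 - f\<^sup>2)
    \<le> (7 * a + 6 * b + 2 * c - e - 2 * f) * ((3 * a + 2 * b - e) / 2)"
proof -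
  have "(7 * a + 6 * b + 2 * c - e - 2 * f) * ((3 * a + 2 * b - e) / 2)
      - 7 * (a * b + b * c + a * c - c\<^sup>2 / 2 - e\<^sup>2 / 2 - f\<^sup>2)
    = 7/2 * (c - 4/7 * a - 5/7 * b - 1/7 * e)\<^sup>2
      + 55/14 * (e - 39/55 * a - 3/5 * b + 7/55 * f)\<^sup>2
      + 14/5 * (b + 1/2 * a - 1/4 * f)\<^sup>2 + 147/22 * (a - 5/42 * f)\<^sup>2 + 20/3 * f\<^sup>2"
    by (simp add: field_simps power2_eq_square)
  also have "\<dots> \<ge> 0"
    by (intro add_nonneg_nonneg mult_nonneg_nonneg) simp_all
  finally show ?thesis
    by simp
qed

lemma antisymmetric_form_le_vertex3:
  fixes a b c e f :: real
  shows "7 * (a * b + b * c + a * c - c\<^sup>2 / 2 - e\<^sup>2 / 2 - f\<^sup>2)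
    \<le> (7 * a + 6 * b + 2 * c - e - 2 * f) * (b + c)"
proof -
  have "(7 * a + 6 * b + 2 * c - e - 2 * f) * (b + c)
      - 7 * (a * b + b * c + a * c - c\<^sup>2 / 2 - e\<^sup>2 / 2 - f\<^sup>2)
    = 7/2 * (e - 1/7 * b - 1/7 * c)\<^sup>2 + 7 * (f - 1/7 * b - 1/7 * c)\<^sup>2
      + 37/7 * (c + 2/37 * b)\<^sup>2 + 427/74 * b\<^sup>2"
    by (simp add: field_simps power2_eq_square)
  also have "\<dots> \<ge> 0"
    by (intro add_nonneg_nonneg mult_nonneg_nonneg) simp_all
  finally show ?thesis
    by simp
qed

text \<open>
  The weights are chosen such that the first-order terms in the antisymmetric part \<open>t\<close> cancel. What
  remains is at most \<open>48 * (7 * area_form t - jubin_form t * (4 * b s t))\<close>, where \<open>s\<close> is the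
  midpoint of \<open>p\<close> and its dual. This is affine in \<open>s\<close>, and \<open>s\<close> is the convex combination of the
  three extreme self-dual configurations with the weights \<open>2 * (f + f')\<close>, \<open>2 * (e + e')\<close> and
  \<open>d + d'\<close>, which are non-negative.
\<close>
lemma weighted_excess_nonpos:
  assumes p: "p = (a, b, c, d, e, f, g)"
    and p': "dual p = (a', b', c', d', e', f', g')"
    and nn: "0 \<le> d + d'" "0 \<le> e + e'" "0 \<le> f + f'"
  shows "jubin_form (dual p) * (48 * area_form p - 7)
    + jubin_form p * (48 * area_form (dual p) - 7) \<le> 0"
proof -
  define ta tb tc te tf where t: "ta = (a - a') / 2" "tb = (b - b') / 2" "tc = (c - c') / 2"
    "te = (e - e') / 2" "tf = (f - f') / 2"
  define q where "q = 7 * (ta * tb + tb * tc + ta * tc - tc\<^sup>2 / 2 - te\<^sup>2 / 2 - tf\<^sup>2)"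
  define l where "l = 7 * ta + 6 * tb + 2 * tc - te - 2 * tf"
  have eqs: "a' = 1 - g - c" "b' = g - d" "c' = g - a" "d' = 1 - g - b" "e' = a + b - e - d - c"
    "f' = 1/2 * (g + d - b) + c - f - a" "g' = 1 - g"
    using p p' by auto
  have X: "jubin_form p = 7/2 + l" "jubin_form (dual p) = 7/2 - l"
    unfolding p' unfolding p eqs l_def t by simp_all argo+
  \<comment> \<open>These three numbers are the barycentric coordinates of the midpoint of \<open>p\<close> and its dual.\<close>
  have W: "2 * (f + f') + 2 * (e + e') + (d + d') = 1"
    unfolding eqs by (simp add: field_simps)
  \<comment> \<open>Twice the area form of the midpoint is \<open>7/24\<close> minus two squares: among the self-dual
    configurations Jubin's one is the best.\<close>
  have S: "area_form p + area_form (dual p)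
      = 2/7 * q + 7/24 - 2 * ((a + a') / 2 - 1/4)\<^sup>2 - 3/2 * ((b + b') / 2 - 1/3)\<^sup>2"
    unfolding p' unfolding p eqs q_def t by (simp add: field_simps power2_eq_square)
  \<comment> \<open>The difference is \<open>4 * b s t\<close>, expanded along the barycentric coordinates of the midpoint \<open>s\<close>.\<close>
  have D: "area_form p - area_form (dual p)
      = 2 * (f + f') * (2 * ta + tb - tf) + 2 * (e + e') * ((3 * ta + 2 * tb - te) / 2)
        + (d + d') * (tb + tc)"
    unfolding p' unfolding p eqs t by (simp add: field_simps power2_eq_square)
  have "(f + f') * (q - l * (2 * ta + tb - tf)) \<le> 0"
    "(e + e') * (q - l * ((3 * ta + 2 * tb - te) / 2)) \<le> 0"
    "(d + d') * (q - l * (tb + tc)) \<le> 0"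
    unfolding q_def l_def using nn antisymmetric_form_le_vertex1
      antisymmetric_form_le_vertex2 antisymmetric_form_le_vertex3
    by (simp_all add: mult_nonneg_nonpos)
  then have "2 * ((f + f') * (q - l * (2 * ta + tb - tf)))
      + 2 * ((e + e') * (q - l * ((3 * ta + 2 * tb - te) / 2)))
      + (d + d') * (q - l * (tb + tc)) \<le> 0"
    by linarith
  also have "2 * ((f + f') * (q - l * (2 * ta + tb - tf)))
      + 2 * ((e + e') * (q - l * ((3 * ta + 2 * tb - te) / 2)))
      + (d + d') * (q - l * (tb + tc))
    = (2 * (f + f') + 2 * (e + e') + (d + d')) * q - l * (area_form p - area_form (dual p))"
    unfolding D by algebra
  finally have ql: "q \<le> l * (area_form p - area_form (dual p))"
    unfolding W by simp
  have "area_form p + area_form (dual p) \<le> 2/7 * q + 7/24"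
    unfolding S using zero_le_power2[of "(a + a') / 2 - 1/4"] zero_le_power2[of "(b + b') / 2 - 1/3"]
    by linarith
  then have "168 * (area_form p + area_form (dual p)) - 49 \<le> 48 * q"
    by simp
  also have "48 * q \<le> 48 * (l * (area_form p - area_form (dual p)))"
    using ql by simp
  finally have "168 * (area_form p + area_form (dual p)) - 49
      - 48 * (l * (area_form p - area_form (dual p))) \<le> 0"
    by simp
  also have "168 * (area_form p + area_form (dual p)) - 49
      - 48 * (l * (area_form p - area_form (dual p)))
    = jubin_form (dual p) * (48 * area_form p - 7)
      + jubin_form p * (48 * area_form (dual p) - 7)"
    unfolding X by algebra
  finally show ?thesis .
qed

lemma jubin_form_dual: "jubin_form p + jubin_form (dual p) = 7"
  by (cases p) (simp add: field_simps)

lemma jubin_form_nonneg: "white_sides_nonneg p \<Longrightarrow> 0 \<le> jubin_form p"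
  by (cases p) auto

text \<open>
  If both areas exceeded \<open>7/48\<close>, then a combination of the two excesses with non-negative weights of
  sum \<open>7\<close> would be positive.
\<close>
lemma army_area_le:
  assumes "p \<in> admissible" shows "army_area p \<le> 7/48"
proof (rule ccontr)
  assume "\<not> army_area p \<le> 7/48"
  then have gt: "48 * area_form p - 7 > 0" "48 * area_form (dual p) - 7 > 0"
    using admissible_areas[OF assms] unfolding army_area_def by auto
  note sides = admissible_sides[OF assms]
  obtain a b c d e f g where p: "p = (a, b, c, d, e, f, g)"
    by (cases p)
  obtain a' b' c' d' e' f' g' where p': "dual p = (a', b', c', d', e', f', g')"
    by (cases "dual p")
  have "jubin_form (dual p) * (48 * area_form p - 7)
      + jubin_form p * (48 * area_form (dual p) - 7) \<le> 0"
    by (rule weighted_excess_nonpos[OF p p']) (use sides(1)[unfolded p] sides(2)[unfolded p'] in auto)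
  moreover have "0 \<le> jubin_form p" "0 \<le> jubin_form (dual p)"
    "jubin_form p + jubin_form (dual p) = 7"
    using sides jubin_form_nonneg jubin_form_dual by auto
  ultimately show False
    using gt
    by (smt (verit) mult_nonneg_nonneg mult_pos_pos)
qed

section \<open>Jubin's configuration\<close>

lemma dual_jubin: "dual jubin = jubin"
  by (simp add: jubin_def)

lemma jubin_sides: "white_sides_nonneg jubin"
  by (simp add: jubin_def)

lemma white_region_eq:
  assumes "white_sides_nonneg (a, b, c, d, e, f, g)"
  shows "white_region (a, b, c, d, e, f, g)
    = interior (cut_parallelogram a b e) \<union> interior (cut_trapezium c d f g)"
  unfolding white_region_def bounds_interior_polygon[OF bounds_white(1)[OF assms]]
    bounds_interior_polygon[OF bounds_white(2)[OF assms]] ..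

lemma white_region_subset_white_pentagons:
  assumes "white_sides_nonneg p" shows "white_region p \<subseteq> white_pentagons p"
proof (cases p)
  case (fields a b c d e f g)
  show ?thesis
    unfolding fields white_region_eq[OF assms[unfolded fields]] white_pentagons.simps
    by (intro Un_mono interior_subset)
qed

lemma open_pentagons_subset_white_region:
  "{(x, y). 0 < x \<and> x < 1/4 \<and> x < y \<and> y < x + 1/3 \<and> y < 1/2} \<subseteq> white_region jubin"
    (is "?S1 \<subseteq> _")
  "{(x, y). 1/2 < x \<and> x < 3/4 \<and> 0 < y \<and> y < x - 1/3 \<and> x + y < 1} \<subseteq> white_region jubin"
    (is "?S2 \<subseteq> _")
proof -
  have "open ?S1" "open ?S2"
    unfolding case_prod_beta by (intro open_Collect_conj open_Collect_less continuous_intros)+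
  moreover have "?S1 \<subseteq> cut_parallelogram (1/4) (1/3) (1/12)"
    by (auto simp: cut_parallelogram_def)
  moreover have "?S2 \<subseteq> cut_trapezium (1/4) (1/6) (1/12) (1/2)"
    by (auto simp: cut_trapezium_def)
  ultimately have "?S1 \<subseteq> interior (cut_parallelogram (1/4) (1/3) (1/12))"
    "?S2 \<subseteq> interior (cut_trapezium (1/4) (1/6) (1/12) (1/2))"
    by (simp_all only: interior_maximal)
  then show "?S1 \<subseteq> white_region jubin" "?S2 \<subseteq> white_region jubin"
    unfolding jubin_def white_region_eq[OF jubin_sides[unfolded jubin_def]]
    by blast+
qed

text \<open>
  The open intervals are the projections of the white pentagons along columns, rows and diagonals,
  and every value in one of them is taken at an explicit white square. The first pentagon has the
  rows \<open>{0<..<1/2}\<close>, which contain all rows of the second, and the antidiagonals of the two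
  pentagons overlap and together fill \<open>{0<..<1}\<close>.
\<close>
lemma jubin_attacks:
  assumes "(x, y) \<in> non_attacked (white_region jubin)"
  shows "x \<notin> {0<..<1/4}" "x \<notin> {1/2<..<3/4}" "y \<notin> {0<..<1/2}" "x + y \<notin> {0<..<1}"
    "y - x \<notin> {0<..<1/3}" "y - x \<notin> {-3/4<..<-1/3}"
proof -
  have 1: "x \<noteq> u \<and> y \<noteq> v \<and> x + y \<noteq> u + v \<and> y - x \<noteq> v - u"
    if "0 < u" "u < 1/4" "u < v" "v < u + 1/3" "v < 1/2" for u v
    using that assms open_pentagons_subset_white_region(1) unfolding non_attacked_def by blast
  have 2: "x \<noteq> u \<and> y \<noteq> v \<and> x + y \<noteq> u + v \<and> y - x \<noteq> v - u"
    if "1/2 < u" "u < 3/4" "0 < v" "v < u - 1/3" "u + v < 1" for u v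
    using that assms open_pentagons_subset_white_region(2) unfolding non_attacked_def by blast
  show "x \<notin> {0<..<1/4}"
    using 1[of x "x + 1/6"] by auto
  show "x \<notin> {1/2<..<3/4}"
    using 2[of x "1/12"] by auto
  show "y \<notin> {0<..<1/2}"
    using 1[of "y / 3" y] by auto
  show "y - x \<notin> {0<..<1/3}"
    using 1[of "1/12" "1/12 + (y - x)"] by auto
  show "y - x \<notin> {-3/4<..<-1/3}"
    using 2[of "3/8 + (x - y) / 2" "3/8 - (x - y) / 2"] by (auto simp: field_simps)
  have "x + y \<notin> {0<..<3/4}"
    using 1[of "(x + y) / 3" "2 * (x + y) / 3"] by (auto simp: field_simps)
  moreover have "x + y \<notin> {1/2<..<1}"
    using 2[of "1/4 + (x + y) / 2" "(x + y) / 2 - 1/4"] by (auto simp: field_simps)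
  ultimately show "x + y \<notin> {0<..<1}"
    by auto
qed

text \<open>
  Off these lines it makes no difference whether boundary points of the white pentagons attack, and
  the unattacked squares outside the black pentagons, such as the centre of the board, lie on them.
\<close>
definition jubin_lines :: "point set" where
  "jubin_lines = {(x, y). x \<in> {0, 1/4, 1/2, 3/4} \<or> y \<in> {0, 1/2}
     \<or> x + y \<in> {0, 1} \<or> y - x \<in> {0, 1/3, -1/3, -3/4}}"

lemma negligible_jubin_lines: "negligible jubin_lines"
proof -
  have lines: "jubin_lines = (\<Union>k\<in>{0, 1/4, 1/2, 3/4}. {z. (1, 0) \<bullet> z = k})
      \<union> (\<Union>k\<in>{0, 1/2}. {z. (0, 1) \<bullet> z = k}) \<union> (\<Union>k\<in>{0, 1}. {z. (1, 1) \<bullet> z = k})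
      \<union> (\<Union>k\<in>{0, 1/3, -1/3, -3/4}. {z. (-1, 1) \<bullet> z = k})"
    by (auto simp: jubin_lines_def)
  show ?thesis
    unfolding lines UN_insert UN_empty Un_empty_right
    by (intro negligible_Un negligible_hyperplane; simp add: zero_prod_def)
qed

lemma jubin_half_turn_white_pentagons:
  "(x, y) \<in> half_turn ` white_pentagons jubin \<longleftrightarrow>
     1/4 \<le> x \<and> x \<le> 1/2 \<and> x + 1/3 \<le> y \<and> 1 \<le> x + y \<and> y \<le> 1 \<or>
     3/4 \<le> x \<and> x \<le> 1 \<and> x - 1/3 \<le> y \<and> y \<le> x \<and> 1/2 \<le> y"
proof -
  have "(x, y) \<in> half_turn ` white_pentagons jubin \<longleftrightarrow> (1 - x, 1 - y) \<in> white_pentagons jubin"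
    by (metis half_turn_Pair half_turn_half_turn image_iff)
  also have "\<dots> \<longleftrightarrow> 1/4 \<le> x \<and> x \<le> 1/2 \<and> x + 1/3 \<le> y \<and> 1 \<le> x + y \<and> y \<le> 1 \<or>
     3/4 \<le> x \<and> x \<le> 1 \<and> x - 1/3 \<le> y \<and> y \<le> x \<and> 1/2 \<le> y"
    by (auto simp: jubin_def cut_parallelogram_def cut_trapezium_def)
  finally show ?thesis .
qed

lemma jubin_black_region:
  "eq_up_to_null (half_turn ` white_pentagons jubin) (black_region jubin)"
proof -
  have "(x, y) \<in> half_turn ` white_pentagons jubin \<longleftrightarrow> (x, y) \<in> black_region jubin"
    if off: "(x, y) \<notin> jubin_lines" for x y
  proof
    assume "(x, y) \<in> half_turn ` white_pentagons jubin"
    then consider "1/4 \<le> x" "x \<le> 1/2" "x + 1/3 \<le> y" "1 \<le> x + y" "y \<le> 1"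
      | "3/4 \<le> x" "x \<le> 1" "x - 1/3 \<le> y" "y \<le> x" "1/2 \<le> y"
      unfolding jubin_half_turn_white_pentagons by blast
    then have *: "(1/4 < x \<and> x < 1/2 \<and> x + 1/3 < y \<and> 1 < x + y \<and> 1/2 < y \<and> y \<le> 1)
      \<or> (3/4 < x \<and> x \<le> 1 \<and> x - 1/3 < y \<and> y < x \<and> 1/2 < y \<and> 1 < x + y)"
      using off by cases (auto simp: jubin_lines_def)
    have "x \<noteq> u \<and> y \<noteq> v \<and> x + y \<noteq> u + v \<and> y - x \<noteq> v - u" if "(u, v) \<in> white_region jubin" for u v
    proof -
      have "(u, v) \<in> white_pentagons jubin"
        using that white_region_subset_white_pentagons jubin_sides by blast
      then have "0 \<le> u \<and> u \<le> 1/4 \<and> u \<le> v \<and> v \<le> u + 1/3 \<and> v \<le> 1/2 \<or>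
        1/2 \<le> u \<and> u \<le> 3/4 \<and> 0 \<le> v \<and> v \<le> u - 1/3 \<and> u + v \<le> 1"
        by (auto simp: jubin_def cut_parallelogram_def cut_trapezium_def)
      with * show ?thesis
        by linarith
    qed
    then show "(x, y) \<in> black_region jubin"
      using * unfolding black_region_def non_attacked_def board_def by auto
  next
    assume B: "(x, y) \<in> black_region jubin"
    then have board: "0 \<le> x" "x \<le> 1" "0 \<le> y" "y \<le> 1"
      unfolding black_region_def non_attacked_def board_def by auto
    note free = jubin_attacks[OF B[unfolded black_region_def]]
    have "1/4 \<le> x" "1/2 \<le> y" "1 \<le> x + y"
      using free board off by (auto simp: jubin_lines_def)
    moreover have "x \<le> 1/2 \<or> 3/4 \<le> x" "y - x \<le> 0 \<or> 1/3 \<le> y - x"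
      "y - x \<le> -3/4 \<or> -1/3 \<le> y - x"
      using free by auto
    \<comment> \<open>This excludes the centre of the board, which satisfies all constraints so far.\<close>
    moreover have "x \<noteq> 1/2"
      using off by (auto simp: jubin_lines_def)
    ultimately show "(x, y) \<in> half_turn ` white_pentagons jubin"
      unfolding jubin_half_turn_white_pentagons using board by argo
  qed
  then have "sym_diff (half_turn ` white_pentagons jubin) (black_region jubin) \<subseteq> jubin_lines"
    by auto
  then show ?thesis
    unfolding eq_up_to_null_iff by (rule negligible_subset[OF negligible_jubin_lines])
qed

lemma jubin_black_polygons:
  "eq_up_to_null (black_region jubin) (polygon (black1 jubin) \<union> polygon (black2 jubin))"
  using half_turn_white_pentagons_eq_black[of jubin] jubin_black_region jubin_sides
  unfolding dual_jubin by (metis eq_up_to_null_sym eq_up_to_null_trans)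

lemma jubin_admissible: "jubin \<in> admissible"
proof -
  have "jubin \<in> unit_cube7" "sides_nonneg jubin"
    "set (white1 jubin) \<union> set (white2 jubin) \<union> set (black1 jubin) \<union> set (black2 jubin) \<subseteq> board"
    by (simp_all add: jubin_def unit_cube7_def board_def)
  then show ?thesis
    using jubin_black_polygons unfolding admissible_def by blast
qed

section \<open>The maximum\<close>

theorem theorem5p3:
  shows "(\<forall>p \<in> admissible. army_area p \<le> 7/48)
    \<and> jubin \<in> admissible
    \<and> army_area jubin = 7/48
    \<and> white_region jubin =
        interior (polygon [(0, 0), (1/4, 1/4), (1/4, 1/2), (1/6, 1/2), (0, 1/3)]) \<union>
        interior (polygon [(1/2, 0), (3/4, 0), (3/4, 1/4), (2/3, 1/3), (1/2, 1/6)])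
    \<and> eq_up_to_null (black_region jubin)
        (polygon [(1/2, 1), (1/4, 1), (1/4, 3/4), (1/3, 2/3), (1/2, 5/6)] \<union>
         polygon [(1, 1), (3/4, 3/4), (3/4, 1/2), (5/6, 1/2), (1, 2/3)])"
proof -
  have "area_form jubin = 7/48"
    by (simp add: jubin_def power2_eq_square)
  then have "army_area jubin = 7/48"
    using admissible_areas[OF jubin_admissible] unfolding army_area_def dual_jubin by simp
  moreover have
    "white1 jubin = [(0, 0), (1/4, 1/4), (1/4, 1/2), (1/6, 1/2), (0, 1/3)]"
    "white2 jubin = [(1/2, 0), (3/4, 0), (3/4, 1/4), (2/3, 1/3), (1/2, 1/6)]"
    "black1 jubin = [(1/2, 1), (1/4, 1), (1/4, 3/4), (1/3, 2/3), (1/2, 5/6)]"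
    "black2 jubin = [(1, 1), (3/4, 3/4), (3/4, 1/2), (5/6, 1/2), (1, 2/3)]"
    by (simp_all add: jubin_def)
  ultimately show ?thesis
    using army_area_le jubin_admissible jubin_black_polygons unfolding white_region_def by simp
qed

end
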